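(* Consider the multivariate response regression model with hidden variables $Y=(\Psi^* )^TX+(B^* )^TZ+E$ described in the context, restricted to the class of configurations in which $Z\in\mathbb{R}^K$ has continuous support and $A^*=\{\mathbb{E}[XX^T]\}^{-1}\mathbb{E}[XZ^T]\neq 0$. Then $\Psi^*$ is not identifiable over this class: there exist two configurations in the class that induce the same joint distribution of the observable pair $(X,Y)$ but have different values of $\Psi^*$.
   Context: Model. $p,m,K$ are positive integers with $K<m$. $Y\in\mathbb{R}^m$ (response), $X\in\mathbb{R}^p$ (observed predictors), $Z\in\mathbb{R}^K$ (unobserved hidden variables), $E\in\mathbb{R}^m$ (error) are mean-zero random vectors with finite second moments satisfying $Y=(\Psi^* )^TX+(B^* )^TZ+E$, where $\Psi^*\in\mathbb{R}^{p\times m}$ and $B^*\in\mathbb{R}^{K\times m}$ are unknown deterministic matrices, $\mathrm{rank}(B^* )=K$, $E$ is independent of $(X,Z)$ with diagonal covariance matrix $\Sigma_E$, $Z$ may be correlated with $X$, and $\Sigma=\mathrm{Cov}(X)$, $\Sigma_Z=\mathrm{Cov}(Z)$ are strictly positive definite. A configuration is a choice of $\Psi^*\in\mathbb{R}^{p\times m}$, $B^*\in\mathbb{R}^{K\times m}$ and a joint law of $(X,Z,E)$ such that $\mathrm{rank}(B^* )=K$, the vectors $X,Z,E$ have mean zero and finite second moments, $E$ is independent of $(X,Z)$ with diagonal covariance matrix, and $\mathrm{Cov}(X)$, $\mathrm{Cov}(Z)$ are strictly positive definite; it induces a joint law of $(X,Y)$ through $Y=(\Psi^* )^TX+(B^*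 )^TZ+E$. "$Z$ has continuous support" means that the (conditional on $X$) law of $Z$ is a continuous distribution, having a density on $\mathbb{R}^K$. Identifiability. A quantity attached to configurations is identifiable over a class of configurations if any two configurations in the class that induce the same joint law of $(X,Y)$ have the same value of that quantity; otherwise it is not identifiable over the class. *)

theory Defs
  imports "HOL-Probability.Probability"
begin

definition second_moment_matrix ::
  "'w measure \<Rightarrow> ('w \<Rightarrow> real^'a) \<Rightarrow> ('w \<Rightarrow> real^'b) \<Rightarrow> real^'b^'a" where
  "second_moment_matrix M U V = (\<chi> i j. integral\<^sup>L M (\<lambda>w. U w $ i * V w $ j))"

definition covariance_matrix :: "'w measure \<Rightarrow> ('w \<Rightarrow> real^'a) \<Rightarrow> real^'a^'a" where
  "covariance_matrix M U =
     (let c = (\<lambda>w. U w - integral\<^sup>L M U) in second_moment_matrix M c c)"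

definition strictly_pos_def :: "real^'a^'a \<Rightarrow> bool" where
  "strictly_pos_def S \<longleftrightarrow> transpose S = S \<and> (\<forall>v. v \<noteq> 0 \<longrightarrow> v \<bullet> (S *v v) > 0)"

definition diagonal_matrix :: "real^'a^'a \<Rightarrow> bool" where
  "diagonal_matrix S \<longleftrightarrow> (\<forall>i j. i \<noteq> j \<longrightarrow> S $ i $ j = 0)"

definition centered_square_integrable :: "'w measure \<Rightarrow> ('w \<Rightarrow> real^'a) \<Rightarrow> bool" where
  "centered_square_integrable M U \<longleftrightarrow>
     U \<in> borel_measurable M \<and> integrable M (\<lambda>w. (norm (U w))\<^sup>2) \<and> integral\<^sup>L M U = 0"

(* The library's indep_var requires both variables to have the same range type, so independence
   of variables with different ranges is independence of the generated sigma-algebras. *)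
definition indep_random_vectors ::
  "'w measure \<Rightarrow> ('w \<Rightarrow> 'a::topological_space) \<Rightarrow> ('w \<Rightarrow> 'b::topological_space) \<Rightarrow> bool" where
  "indep_random_vectors M U V \<longleftrightarrow>
     prob_space.indep_set M (sets (vimage_algebra (space M) U borel))
                            (sets (vimage_algebra (space M) V borel))"

definition regular_conditional_law ::
  "'w measure \<Rightarrow> ('w \<Rightarrow> 'a::topological_space) \<Rightarrow> ('w \<Rightarrow> 'b::topological_space)
     \<Rightarrow> ('a \<Rightarrow> 'b measure) \<Rightarrow> bool" where
  "regular_conditional_law M U V \<kappa> \<longleftrightarrow>
     \<kappa> \<in> borel \<rightarrow>\<^sub>M prob_algebra borel \<and>
     (\<forall>A\<in>sets borel. \<forall>B\<in>sets borel.
        emeasure M {w \<in> space M. U w \<in> A \<and> V w \<in> B}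
          = (\<integral>\<^sup>+u\<in>A. emeasure (\<kappa> u) B \<partial>distr M borel U))"

(* The conditional law of V given U has a Lebesgue density for almost every value of U;
   in particular V itself then has a density. *)
definition conditionally_continuous ::
  "'w measure \<Rightarrow> ('w \<Rightarrow> real^'a) \<Rightarrow> ('w \<Rightarrow> real^'b) \<Rightarrow> bool" where
  "conditionally_continuous M U V \<longleftrightarrow>
     (\<exists>\<kappa>. regular_conditional_law M U V \<kappa> \<and>
        (AE u in distr M borel U. \<exists>f\<in>borel_measurable lborel. \<kappa> u = density lborel f))"

(* law is the joint law of (X, Z, E); the random vectors are the coordinate maps. *)
record ('p::finite, 'm::finite, 'k::finite) configuration =
  Psi :: "real^'m^'p"
  loading :: "real^'m^'k"
  law :: "((real^'p) \<times> (real^'k) \<times> (real^'m)) measure"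

definition predictor :: "(real^'p) \<times> (real^'k) \<times> (real^'m) \<Rightarrow> real^'p" where
  "predictor = (\<lambda>(x, z, e). x)"

definition hidden :: "(real^'p) \<times> (real^'k) \<times> (real^'m) \<Rightarrow> real^'k" where
  "hidden = (\<lambda>(x, z, e). z)"

definition noise :: "(real^'p) \<times> (real^'k) \<times> (real^'m) \<Rightarrow> real^'m" where
  "noise = (\<lambda>(x, z, e). e)"

definition response ::
  "('p::finite, 'm::finite, 'k::finite) configuration \<Rightarrow> (real^'p) \<times> (real^'k) \<times> (real^'m) \<Rightarrow> real^'m"
  where
  "response c w =
     transpose (Psi c) *v predictor w + transpose (loading c) *v hidden w + noise w"

definition valid_configuration ::
  "('p::finite, 'm::finite, 'k::finite) configuration \<Rightarrow> bool" where
  "valid_configuration c \<longleftrightarrow>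
     rank (loading c) = CARD('k) \<and>
     prob_space (law c) \<and> sets (law c) = sets borel \<and>
     centered_square_integrable (law c) predictor \<and>
     centered_square_integrable (law c) hidden \<and>
     centered_square_integrable (law c) noise \<and>
     indep_random_vectors (law c) noise (\<lambda>w. (predictor w, hidden w)) \<and>
     diagonal_matrix (covariance_matrix (law c) noise) \<and>
     strictly_pos_def (covariance_matrix (law c) predictor) \<and>
     strictly_pos_def (covariance_matrix (law c) hidden)"

definition observed_law ::
  "('p::finite, 'm::finite, 'k::finite) configuration \<Rightarrow> ((real^'p) \<times> (real^'m)) measure" where
  "observed_law c = distr (law c) borel (\<lambda>w. (predictor w, response c w))"

definition A_star :: "('p::finite, 'm::finite, 'k::finite) configuration \<Rightarrow> real^'k^'p" where
  "A_star c =
     matrix_inv (second_moment_matrix (law c) predictor predictor)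
       ** second_moment_matrix (law c) predictor hidden"

definition continuous_confounded_class ::
  "('p::finite, 'm::finite, 'k::finite) configuration set" where
  "continuous_confounded_class =
     {c. valid_configuration c \<and> conditionally_continuous (law c) predictor hidden \<and> A_star c \<noteq> 0}"

definition identifiable_over :: "'c set \<Rightarrow> ('c \<Rightarrow> 'o) \<Rightarrow> ('c \<Rightarrow> 'q) \<Rightarrow> bool" where
  "identifiable_over C obs q \<longleftrightarrow> (\<forall>c\<in>C. \<forall>c'\<in>C. obs c = obs c' \<longrightarrow> q c = q c')"

end

theory Submission
  imports Defs
begin

text \<open>Take \<open>X\<close> and \<open>W\<close> independent and uniform on unit balls, \<open>E = 0\<close>, and \<open>B\<close> of full rank. For
  every matrix \<open>A\<close>, the choice \<open>Z = W + A\<^sup>T X\<close>, \<open>\<Psi> = - A B\<close> yields \<open>Y = B\<^sup>T W\<close>, so the law of \<open>(X, Y)\<close>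
  does not depend on \<open>A\<close>, although \<open>A\<^sup>* = A\<close> and \<open>\<Psi>\<close> do.\<close>

text \<open>This simp rule turns \<open>transpose A *v x\<close> into \<open>x v* A\<close>, a form
  that the rules for \<open>*v\<close> used below do not match.\<close>

declare transpose_matrix_vector [simp del]

section \<open>Measurability and second moment matrices\<close>

lemma borel_measurable_vec_nth [measurable (raw)]:
  fixes f :: "'w \<Rightarrow> real^'a::finite"
  assumes "f \<in> borel_measurable M"
  shows "(\<lambda>w. f w $ i) \<in> borel_measurable M"
  using assms by (rule measurable_compose) (intro borel_measurable_continuous_onI continuous_intros)

lemma borel_measurable_matrix_vector_mult [measurable (raw)]:
  fixes f :: "'w \<Rightarrow> real^'a::finite" and A :: "real^'a^'b::finite"
  assumes "f \<in> borel_measurable M"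
  shows "(\<lambda>w. A *v f w) \<in> borel_measurable M"
  using assms
  by (rule measurable_compose)
    (intro borel_measurable_continuous_onI linear_continuous_on matrix_vector_mul_bounded_linear)

text \<open>A coordinate is bounded by the norm and ab <= a^2 + b^2 for a, b >= 0, so the sum of the
  two squared norms dominates.\<close>

lemma centered_square_integrable_integrable_mult:
  assumes "centered_square_integrable M U" "centered_square_integrable M V"
  shows "integrable M (\<lambda>w. U w $ i * V w $ j)"
proof (rule Bochner_Integration.integrable_bound)
  show "integrable M (\<lambda>w. (norm (U w))\<^sup>2 + (norm (V w))\<^sup>2)"
    using assms by (simp add: centered_square_integrable_def)
  have [measurable]: "U \<in> borel_measurable M" "V \<in> borel_measurable M"
    using assms by (auto simp: centered_square_integrable_def)
  show "(\<lambda>w. U w $ i * V w $ j) \<in> borel_measurable M"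
    by measurable
  have "norm (U w $ i * V w $ j) \<le> (norm (U w))\<^sup>2 + (norm (V w))\<^sup>2" for w
  proof -
    have "norm (U w $ i * V w $ j) \<le> norm (U w) * norm (V w)"
      unfolding norm_mult by (intro mult_mono) (auto simp: component_le_norm_cart)
    also have "\<dots> \<le> (norm (U w))\<^sup>2 + (norm (V w))\<^sup>2"
      using sum_squares_bound[of "norm (U w)" "norm (V w)"]
        mult_nonneg_nonneg[OF norm_ge_zero[of "U w"] norm_ge_zero[of "V w"]] by linarith
    finally show ?thesis .
  qed
  then show "AE w in M. norm (U w $ i * V w $ j) \<le> norm ((norm (U w))\<^sup>2 + (norm (V w))\<^sup>2)"
    by simp
qed

lemma covariance_matrix_centered:
  assumes "centered_square_integrable M U"
  shows "covariance_matrix M U = second_moment_matrix M U U"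
  using assms by (simp add: covariance_matrix_def centered_square_integrable_def)

lemma second_moment_matrix_distr:
  assumes [measurable]: "T \<in> measurable M N" "U \<in> borel_measurable N" "V \<in> borel_measurable N"
  shows "second_moment_matrix (distr M N T) U V
           = second_moment_matrix M (\<lambda>w. U (T w)) (\<lambda>w. V (T w))"
  by (simp add: second_moment_matrix_def integral_distr)

lemma centered_square_integrable_distr:
  assumes [measurable]: "T \<in> measurable M N" "U \<in> borel_measurable N"
    and "centered_square_integrable M (\<lambda>w. U (T w))"
  shows "centered_square_integrable (distr M N T) U"
  using assms(3) unfolding centered_square_integrable_def
  by (simp add: integral_distr integrable_distr_eq)

text \<open>Expanding the square shows that the quadratic form at \<open>v\<close> is the mean of (v
  . U)^2. A nonnegative function has integral 0 only if it vanishes almost everywhere, which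
  \<open>nondegenerate\<close> excludes.\<close>

lemma strictly_pos_def_second_moment_matrix:
  fixes U :: "'w \<Rightarrow> real^'a::finite"
  assumes U: "centered_square_integrable M U"
    and nondegenerate: "\<And>v. v \<noteq> 0 \<Longrightarrow> \<not> (AE w in M. v \<bullet> U w = 0)"
  shows "strictly_pos_def (second_moment_matrix M U U)"
  unfolding strictly_pos_def_def
proof (intro conjI allI impI)
  let ?S = "second_moment_matrix M U U"
  show "transpose ?S = ?S"
    by (simp add: second_moment_matrix_def transpose_def vec_eq_iff mult.commute)
  fix v :: "real^'a"
  assume "v \<noteq> 0"
  have int: "integrable M (\<lambda>w. U w $ i * U w $ j)" for i j
    using centered_square_integrable_integrable_mult[OF U U] .
  have sq: "(v \<bullet> U w)\<^sup>2 = (\<Sum>i\<in>UNIV. \<Sum>j\<in>UNIV. v $ i * v $ j * (U w $ i * U w $ j))" for w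
    by (simp add: inner_vec_def power2_eq_square sum_product algebra_simps)
  have int_sq: "integrable M (\<lambda>w. (v \<bullet> U w)\<^sup>2)"
    unfolding sq by (intro Bochner_Integration.integrable_sum integrable_mult_right int)
  have "v \<bullet> (?S *v v) = (\<Sum>i\<in>UNIV. \<Sum>j\<in>UNIV. v $ i * v $ j * integral\<^sup>L M (\<lambda>w. U w $ i * U w $ j))"
    by (simp add: inner_vec_def matrix_vector_mult_def second_moment_matrix_def sum_distrib_left
        algebra_simps)
  also have "\<dots> = integral\<^sup>L M (\<lambda>w. (v \<bullet> U w)\<^sup>2)"
    unfolding sq by (simp add: Bochner_Integration.integral_sum int)
  finally have eq: "v \<bullet> (?S *v v) = integral\<^sup>L M (\<lambda>w. (v \<bullet> U w)\<^sup>2)" .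
  have "integral\<^sup>L M (\<lambda>w. (v \<bullet> U w)\<^sup>2) \<noteq> 0"
    using nondegenerate[OF \<open>v \<noteq> 0\<close>] integral_nonneg_eq_0_iff_AE[OF int_sq] by simp
  moreover have "integral\<^sup>L M (\<lambda>w. (v \<bullet> U w)\<^sup>2) \<ge> 0"
    by simp
  ultimately show "v \<bullet> (?S *v v) > 0"
    unfolding eq by linarith
qed

lemma strictly_pos_def_invertible:
  fixes S :: "real^'a::finite^'a"
  assumes "strictly_pos_def S"
  shows "invertible S"
proof -
  have "x = 0" if "S *v x = 0" for x
    using assms that by (metis inner_zero_right less_irrefl strictly_pos_def_def)
  then show ?thesis
    unfolding invertible_left_inverse matrix_left_invertible_ker by blast
qed

section \<open>Symmetry, null sets and the uniform law on the unit ball\<close>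

lemma lborel_distr_uminus_euclidean:
  "distr lborel borel uminus = (lborel :: 'a::euclidean_space measure)"
  by (subst (2) lborel_affine[of "-1" 0]) (auto simp: density_1)

lemma AE_lborel_not_hyperplane:
  fixes v :: "'a::euclidean_space"
  assumes "v \<noteq> 0"
  shows "AE x in lborel. v \<bullet> x \<noteq> c"
proof -
  have "{x. v \<bullet> x = c} \<in> null_sets lebesgue"
    using negligible_hyperplane[of v c] assms by (simp add: negligible_iff_null_sets)
  then have "AE x in lebesgue. x \<notin> {x. v \<bullet> x = c}"
    by (rule AE_not_in)
  \<comment> \<open>Negligibility speaks of the completion \<open>lebesgue\<close>;
    almost-everywhere statements over it and over \<open>lborel\<close> agree.\<close>
  then show ?thesis
    by (simp add: AE_completion_iff)
qed

lemma integral_odd_eq_0: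
  fixes f :: "'a \<Rightarrow> 'b::{banach, second_countable_topology}"
  assumes [measurable]: "T \<in> measurable M M" "f \<in> borel_measurable M"
    and inv: "distr M M T = M" and odd: "\<And>x. f (T x) = - f x"
  shows "integral\<^sup>L M f = 0"
proof -
  have "integral\<^sup>L M f = integral\<^sup>L (distr M M T) f"
    by (simp add: inv)
  \<comment> \<open>The sign rule is safe without integrability: a non-integrable function has
    Bochner integral 0 by convention.\<close>
  also have "\<dots> = - integral\<^sup>L M f"
    by (simp add: integral_distr odd)
  finally have "2 *\<^sub>R integral\<^sup>L M f = 0"
    by (metis add.right_inverse scaleR_2)
  then show ?thesis
    by simp
qed

text \<open>One law meets all demands: bounded support gives finite moments, symmetry under negation
  gives mean zero, and a Lebesgue density gives continuity and leaves hyperplanes without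
  mass.\<close>

definition uniform_ball :: "'a::euclidean_space measure" where
  "uniform_ball = uniform_measure lborel (cball 0 1)"

text \<open>Both facts are needed for normalisation to yield a probability measure. The volume is
  nonzero because the closed ball contains a nonempty open set.\<close>

lemma emeasure_unit_cball:
  "emeasure lborel (cball (0::'a::euclidean_space) 1) \<noteq> 0"
  "emeasure lborel (cball (0::'a::euclidean_space) 1) < \<infinity>"
proof -
  have "negligible (cball (0::'a) 1) \<longleftrightarrow> emeasure lborel (cball (0::'a) 1) = 0"
    by (simp add: negligible_iff_null_sets null_sets_def)
  moreover have "\<not> negligible (cball (0::'a) 1)"
    by (metis ball_subset_cball negligible_subset open_ball open_not_negligible ball_eq_empty
        not_one_le_zero)
  ultimately show "emeasure lborel (cball (0::'a) 1) \<noteq> 0"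
    by simp
qed (rule emeasure_lborel_cball_finite)

lemma prob_space_uniform_ball: "prob_space uniform_ball"
  unfolding uniform_ball_def
  using emeasure_unit_cball by (intro prob_space_uniform_measure) (simp_all add: less_top)

interpretation uniform_ball: prob_space "uniform_ball :: 'a::euclidean_space measure"
  by (rule prob_space_uniform_ball)

lemma sets_uniform_ball [simp, measurable_cong]: "sets uniform_ball = sets borel"
  by (simp add: uniform_ball_def)

lemma space_uniform_ball [simp]: "space uniform_ball = UNIV"
  by (simp add: uniform_ball_def)

lemma AE_uniform_ball_norm_le: "AE x in uniform_ball. norm x \<le> 1"
  unfolding uniform_ball_def by (rule AE_uniform_measureI) auto

lemma AE_uniform_ball_not_hyperplane:
  assumes "v \<noteq> 0"
  shows "AE x in uniform_ball. v \<bullet> x \<noteq> c"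
  unfolding uniform_ball_def
  using AE_lborel_not_hyperplane[OF assms, of c]
  by (intro AE_uniform_measureI) (auto elim: eventually_mono)

text \<open>The density \<open>g\<close> is even and Lebesgue measure is invariant under
  negation.\<close>

lemma distr_uniform_ball_uminus: "distr uniform_ball borel uminus = uniform_ball"
proof -
  define g :: "'a \<Rightarrow> ennreal" where "g = (\<lambda>x. indicator (cball 0 1) x / emeasure lborel (cball (0::'a) 1))"
  have [measurable]: "g \<in> borel_measurable borel"
    unfolding g_def by (intro borel_measurable_divide_ennreal borel_measurable_indicator) auto
  have u: "uniform_ball = density lborel g"
    unfolding uniform_ball_def uniform_measure_def g_def ..
  have "uniform_ball = density (distr lborel borel uminus) g"
    unfolding u lborel_distr_uminus_euclidean ..
  also have "\<dots> = distr (density lborel (\<lambda>x. g (- x))) borel uminus"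
    by (rule density_distr) auto
  also have "(\<lambda>x. g (- x)) = g"
    by (auto simp: g_def indicator_def)
  finally show ?thesis
    unfolding u ..
qed

text \<open>Translation invariance of Lebesgue measure shifts the density. With \<open>c\<close> =
  A^T x this gives the density of the hidden variable conditional on X = x.\<close>

lemma distr_uniform_ball_plus:
  "\<exists>f\<in>borel_measurable lborel. distr uniform_ball borel (\<lambda>w. w + c) = density lborel f"
proof -
  define g :: "'a \<Rightarrow> ennreal" where "g = (\<lambda>x. indicator (cball 0 1) x / emeasure lborel (cball (0::'a) 1))"
  have [measurable]: "g \<in> borel_measurable borel"
    unfolding g_def by (intro borel_measurable_divide_ennreal borel_measurable_indicator) auto
  have "density lborel (\<lambda>z. g (z - c)) = density (distr lborel borel ((+) c)) (\<lambda>z. g (z - c))"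
    unfolding lborel_distr_plus ..
  also have "\<dots> = distr (density lborel (\<lambda>x. g (c + x - c))) borel ((+) c)"
    by (rule density_distr) auto
  also have "\<dots> = distr uniform_ball borel (\<lambda>w. w + c)"
    unfolding uniform_ball_def uniform_measure_def g_def
    by (intro arg_cong3[of _ _ borel borel _ _ distr]) (simp_all add: fun_eq_iff add.commute)
  finally show ?thesis
    by (intro bexI[of _ "\<lambda>z. g (z - c)"]) auto
qed

section \<open>Independent pairs of uniform points\<close>

abbreviation ball_pair :: "('a::euclidean_space \<times> 'b::euclidean_space) measure" where
  "ball_pair \<equiv> uniform_ball \<Otimes>\<^sub>M uniform_ball"

interpretation ball_pair: pair_prob_space
  "uniform_ball :: 'a::euclidean_space measure" "uniform_ball :: 'b::euclidean_space measure" ..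

lemma sets_ball_pair [simp]:
  "sets (ball_pair :: ('a::euclidean_space \<times> 'b::euclidean_space) measure) = sets borel"
  by (simp add: borel_prod[symmetric] cong: sets_pair_measure_cong)

text \<open>Symmetries may be applied to each coordinate separately: negating both yields zero
  means, negating only the second yields zero correlation.\<close>

lemma distr_ball_pair_map_prod:
  assumes [measurable]: "f \<in> borel_measurable borel" "g \<in> borel_measurable borel"
    and "distr uniform_ball borel f = uniform_ball" "distr uniform_ball borel g = uniform_ball"
  shows "distr ball_pair ball_pair (\<lambda>(x, w). (f x, g w)) = ball_pair"
proof -
  have "ball_pair = distr uniform_ball borel f \<Otimes>\<^sub>M distr uniform_ball borel g"
    by (simp add: assms)
  also have "\<dots> = distr ball_pair (borel \<Otimes>\<^sub>M borel) (\<lambda>(x, w). (f x, g w))"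
    by (intro pair_measure_distr) (auto simp: assms uniform_ball.sigma_finite_measure_axioms)
  also have "\<dots> = distr ball_pair ball_pair (\<lambda>(x, w). (f x, g w))"
    by (intro distr_cong) (auto simp: borel_prod)
  finally show ?thesis ..
qed

lemma AE_ball_pair_norm_le: "AE p in ball_pair. norm p \<le> 2"
proof (rule ball_pair.AE_pair_measure)
  show "{p \<in> space ball_pair. norm p \<le> 2} \<in> sets (ball_pair :: ('a \<times> 'b) measure)"
    unfolding sets_ball_pair by (simp add: space_pair_measure)
  have "AE w in uniform_ball. norm (x, w) \<le> 2" if "norm x \<le> 1" for x :: 'a
    using AE_uniform_ball_norm_le
  proof eventually_elim
    case (elim w)
    then show ?case
      using that norm_Pair_le[of x w] by linarith
  qed
  then show "AE x in uniform_ball. AE w in uniform_ball. norm (x::'a, w::'b) \<le> 2"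
    using AE_uniform_ball_norm_le by (rule eventually_mono[rotated])
qed

text \<open>A linear image of the pair is almost surely bounded, hence square integrable, and it is
  odd under the negation that preserves the law. Predictor, hidden variable and noise will all be
  such images.\<close>

lemma centered_square_integrable_ball_pair:
  fixes h :: "'a::euclidean_space \<times> 'b::euclidean_space \<Rightarrow> real^'n::finite"
  assumes h: "bounded_linear h"
  shows "centered_square_integrable ball_pair h"
  unfolding centered_square_integrable_def
proof (intro conjI)
  interpret h: bounded_linear h by (rule h)
  show meas [measurable]: "h \<in> borel_measurable ball_pair"
    by (simp add: measurable_cong_sets[OF sets_ball_pair refl] borel_measurable_continuous_onI
        h.continuous_on)
  obtain K where K: "\<And>p. norm (h p) \<le> norm p * K" "0 < K"
    using h.pos_bounded by blast
  show "integrable ball_pair (\<lambda>p. (norm (h p))\<^sup>2)"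
  proof (rule ball_pair.P.integrable_const_bound)
    show "AE p in ball_pair. norm ((norm (h p))\<^sup>2) \<le> (2 * K)\<^sup>2"
      using AE_ball_pair_norm_le
    proof eventually_elim
      case (elim p)
      have "norm (h p) \<le> 2 * K"
        using K(1)[of p] mult_right_mono[OF elim, of K] K(2) by linarith
      then show ?case
        using power_mono[of "norm (h p)" "2 * K" 2] by simp
    qed
  qed measurable
  show "integral\<^sup>L ball_pair h = 0"
  proof (rule integral_odd_eq_0)
    show "distr ball_pair ball_pair (\<lambda>(x, w). (- x, - w))
            = (ball_pair :: ('a \<times> 'b) measure)"
      by (intro distr_ball_pair_map_prod distr_uniform_ball_uminus) auto
    show "(\<lambda>(x, w). (- x, - w)) \<in> measurable ball_pair (ball_pair :: ('a \<times> 'b) measure)"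
      by measurable
    show "h (case p of (x, w) \<Rightarrow> (- x, - w)) = - h p" for p
      by (cases p) (simp add: linear_neg[OF h.linear, symmetric])
  qed measurable
qed

text \<open>Negating the second coordinate alone preserves the law and reverses the sign of every
  product.\<close>

lemma second_moment_matrix_fst_snd_ball_pair:
  "second_moment_matrix ball_pair fst snd = (0 :: real^'b::finite^'a::finite)"
proof -
  have "integral\<^sup>L ball_pair (\<lambda>p :: (real^'a) \<times> (real^'b). fst p $ i * snd p $ j) = 0" for i j
  proof (rule integral_odd_eq_0)
    show "distr ball_pair ball_pair (\<lambda>(x, w). (x, - w))
            = (ball_pair :: ((real^'a) \<times> (real^'b)) measure)"
      by (intro distr_ball_pair_map_prod distr_uniform_ball_uminus)
        (auto simp: distr_id2)
  qed (measurable, auto)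
  then show ?thesis
    by (simp add: second_moment_matrix_def vec_eq_iff)
qed

lemma not_AE_ball_pair_fst:
  assumes "v \<noteq> 0"
  shows "\<not> (AE p in (ball_pair :: ('a::euclidean_space \<times> 'b::euclidean_space) measure). v \<bullet> fst p = 0)"
proof
  assume "AE p in (ball_pair :: ('a \<times> 'b) measure). v \<bullet> fst p = 0"
  then have "AE x in uniform_ball. AE w in (uniform_ball :: 'b measure). v \<bullet> x = 0"
    using ball_pair.AE_pair by fastforce
  then have "AE x in (uniform_ball :: 'a measure). False"
    using AE_uniform_ball_not_hyperplane[OF assms, of 0] by eventually_elim simp
  then show False
    by simp
qed

text \<open>For fixed \<open>x\<close> the equation confines \<open>w\<close> to a hyperplane
  orthogonal to \<open>v\<close>, which has mass zero, whatever the shift \<open>h x\<close> is. By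
  Fubini this makes the covariance of the sheared hidden variable nondegenerate.\<close>

lemma not_AE_ball_pair_snd_plus:
  assumes "v \<noteq> 0"
  shows "\<not> (AE p in (ball_pair :: ('a::euclidean_space \<times> 'b::euclidean_space) measure).
              v \<bullet> (snd p + h (fst p)) = 0)"
proof
  assume "AE p in (ball_pair :: ('a \<times> 'b) measure). v \<bullet> (snd p + h (fst p)) = 0"
  then have "AE x in (uniform_ball :: 'a measure). AE w in (uniform_ball :: 'b measure).
      v \<bullet> (w + h x) = 0"
    using ball_pair.AE_pair by fastforce
  then have "AE x in (uniform_ball :: 'a measure). False"
  proof eventually_elim
    case (elim x)
    have "AE w in (uniform_ball :: 'b measure). False"
      using elim AE_uniform_ball_not_hyperplane[OF assms, of "- (v \<bullet> h x)"]
      by eventually_elim (simp add: inner_add_right)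
    then show ?case
      by simp
  qed
  then show False
    by simp
qed

section \<open>The family of sheared configurations\<close>

definition shear :: "real^'k^'p \<Rightarrow> (real^'p) \<times> (real^'k)
    \<Rightarrow> (real^'p::finite) \<times> (real^'k::finite) \<times> (real^'m::finite)" where
  "shear A = (\<lambda>(x, w). (x, w + transpose A *v x, 0))"

definition sheared_configuration ::
  "real^'m^'k \<Rightarrow> real^'k^'p \<Rightarrow> ('p::finite, 'm::finite, 'k::finite) configuration" where
  "sheared_configuration B A =
     \<lparr>Psi = - (A ** B), loading = B, law = distr ball_pair borel (shear A)\<rparr>"

lemma shear_simps [simp]:
  "predictor (shear A p) = fst p"
  "hidden (shear A p) = snd p + transpose A *v fst p"
  "noise (shear A p) = 0"
  by (simp_all add: predictor_def hidden_def noise_def shear_def split_beta)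

lemma measurable_coordinates [measurable]:
  "predictor \<in> borel_measurable borel"
  "hidden \<in> borel_measurable borel"
  "noise \<in> borel_measurable borel"
  unfolding predictor_def hidden_def noise_def split_beta
  by (intro borel_measurable_continuous_onI continuous_intros)+

lemma measurable_shear [measurable]: "shear A \<in> borel_measurable ball_pair"
proof -
  have "shear A \<in> borel_measurable borel"
    unfolding shear_def split_beta borel_prod[symmetric] by measurable
  then show ?thesis
    by (simp add: measurable_cong_sets[OF sets_ball_pair refl])
qed

lemma bounded_linear_hidden_shear:
  "bounded_linear (\<lambda>p. snd p + transpose A *v fst p :: real^'k::finite)"
  by (intro bounded_linear_add bounded_linear_snd
      bounded_linear_compose[OF matrix_vector_mul_bounded_linear bounded_linear_fst])

text \<open>Expanding Z = W + A^T X gives E[X Z^T] = E[X W^T] + E[X X^T] A, and the first term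
  vanishes by symmetry.\<close>

lemma second_moment_matrix_hidden_shear:
  fixes A :: "real^'k::finite^'p::finite"
  shows "second_moment_matrix ball_pair fst (\<lambda>p. snd p + transpose A *v fst p)
    = second_moment_matrix (ball_pair :: ((real^'p) \<times> (real^'k)) measure) fst fst ** A"
proof -
  let ?M = "ball_pair :: ((real^'p) \<times> (real^'k)) measure"
  have fst: "centered_square_integrable ?M fst" and snd: "centered_square_integrable ?M snd"
    by (intro centered_square_integrable_ball_pair bounded_linear_fst bounded_linear_snd)+
  note int = centered_square_integrable_integrable_mult[OF fst fst]
    centered_square_integrable_integrable_mult[OF fst snd]
  have cross: "integral\<^sup>L ?M (\<lambda>p. fst p $ i * snd p $ j) = 0" for i j
    using arg_cong[OF second_moment_matrix_fst_snd_ball_pair, of "\<lambda>S. S $ i $ j"]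
    by (simp add: second_moment_matrix_def)
  have "fst p $ i * (snd p + transpose A *v fst p) $ j
      = fst p $ i * snd p $ j + (\<Sum>l\<in>UNIV. A $ l $ j * (fst p $ i * fst p $ l))"
    for p :: "(real^'p) \<times> (real^'k)" and i j
    by (simp add: matrix_vector_mult_def transpose_def sum_distrib_left algebra_simps)
  then have "integral\<^sup>L ?M (\<lambda>p. fst p $ i * (snd p + transpose A *v fst p) $ j)
      = (\<Sum>l\<in>UNIV. A $ l $ j * integral\<^sup>L ?M (\<lambda>p. fst p $ i * fst p $ l))" for i j
    by (simp only:) (simp add: int cross Bochner_Integration.integral_sum)
  then show ?thesis
    by (simp add: second_moment_matrix_def matrix_matrix_mult_def vec_eq_iff mult.commute)
qed

text \<open>Every event generated by \<open>U\<close> has probability 1 or 0, according to whether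
  \<open>c\<close> lies in the Borel set, and such events are independent of all others. It serves
  the noise, which is identically 0 after the shear.\<close>

lemma (in prob_space) indep_random_vectors_AE_const:
  fixes U :: "'a \<Rightarrow> 'b::topological_space" and V :: "'a \<Rightarrow> 'c::topological_space"
  assumes U [measurable]: "U \<in> borel_measurable M" and V [measurable]: "V \<in> borel_measurable M"
    and const: "AE w in M. U w = c"
  shows "indep_random_vectors M U V"
  unfolding indep_random_vectors_def
proof (rule indep_setI)
  show "sets (vimage_algebra (space M) U borel) \<subseteq> events"
    "sets (vimage_algebra (space M) V borel) \<subseteq> events"
    by (auto simp: sets_vimage_algebra2)
  fix a b
  assume "a \<in> sets (vimage_algebra (space M) U borel)" "b \<in> sets (vimage_algebra (space M) V borel)"
  then obtain S T where S [measurable]: "S \<in> sets borel" and a: "a = U -` S \<inter> space M"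
    and T [measurable]: "T \<in> sets borel" and b: "b = V -` T \<inter> space M"
    by (auto simp: sets_vimage_algebra2)
  have [measurable]: "a \<in> events" "b \<in> events"
    unfolding a b by measurable
  show "prob (a \<inter> b) = prob a * prob b"
  proof (cases "c \<in> S")
    case True
    have "AE w in M. w \<in> a"
      using const AE_space by eventually_elim (simp add: a True)
    then have "prob a = 1" "prob (a \<inter> b) = prob b"
      by (auto simp: prob_eq_1 intro!: finite_measure_eq_AE)
    then show ?thesis
      by simp
  next
    case False
    have "AE w in M. w \<notin> a"
      using const by eventually_elim (simp add: a False)
    then have "prob a = prob {}" "prob (a \<inter> b) = prob {}"
      by (intro finite_measure_eq_AE; auto)+
    then show ?thesis
      by simp
  qed
qed

section \<open>Membership in the class\<close>

lemma valid_sheared_configuration: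
  assumes "rank (B :: real^'m^'k) = CARD('k)"
  shows "valid_configuration (sheared_configuration B A :: ('p::finite, 'm::finite, 'k::finite) configuration)"
proof -
  let ?L = "distr ball_pair borel (shear A) :: ((real^'p) \<times> (real^'k) \<times> (real^'m)) measure"
  interpret L: prob_space ?L
    by (rule ball_pair.P.prob_space_distr) measurable
  have X: "centered_square_integrable ball_pair (\<lambda>p. predictor (shear A p :: (real^'p) \<times> (real^'k) \<times> (real^'m)))"
    and Z: "centered_square_integrable ball_pair (\<lambda>p. hidden (shear A p :: (real^'p) \<times> (real^'k) \<times> (real^'m)))"
    and E: "centered_square_integrable ball_pair (\<lambda>p. noise (shear A p :: (real^'p) \<times> (real^'k) \<times> (real^'m)))"
    by (simp_all add: centered_square_integrable_ball_pair bounded_linear_fst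
        bounded_linear_hidden_shear bounded_linear_zero)
  have X': "centered_square_integrable ?L predictor" and Z': "centered_square_integrable ?L hidden"
    and E': "centered_square_integrable ?L noise"
    by (intro centered_square_integrable_distr measurable_shear measurable_coordinates X Z E)+
  have "strictly_pos_def (covariance_matrix ?L predictor)"
    unfolding covariance_matrix_centered[OF X']
    by (subst second_moment_matrix_distr, measurable,
        intro strictly_pos_def_second_moment_matrix X) (simp add: not_AE_ball_pair_fst)
  moreover have "strictly_pos_def (covariance_matrix ?L hidden)"
    unfolding covariance_matrix_centered[OF Z']
    by (subst second_moment_matrix_distr, measurable,
        intro strictly_pos_def_second_moment_matrix Z) (simp add: not_AE_ball_pair_snd_plus)
  moreover have "diagonal_matrix (covariance_matrix ?L noise)"
    unfolding covariance_matrix_centered[OF E']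
    by (subst second_moment_matrix_distr)
      (simp_all add: diagonal_matrix_def second_moment_matrix_def)
  moreover have "indep_random_vectors ?L noise (\<lambda>w. (predictor w, hidden w))"
  proof (rule L.indep_random_vectors_AE_const)
    show "AE w in ?L. noise w = 0"
      by (subst AE_distr_iff) auto
  qed (simp_all add: borel_measurable_Pair)
  ultimately show ?thesis
    using X' Z' E' L.prob_space_axioms assms
    by (simp add: valid_configuration_def sheared_configuration_def)
qed

lemma A_star_sheared_configuration:
  "A_star (sheared_configuration B A :: ('p::finite, 'm::finite, 'k::finite) configuration) = A"
proof -
  let ?M = "ball_pair :: ((real^'p) \<times> (real^'k)) measure"
  let ?S = "second_moment_matrix ?M fst fst"
  have "strictly_pos_def ?S"
    by (intro strictly_pos_def_second_moment_matrix centered_square_integrable_ball_pair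
        bounded_linear_fst not_AE_ball_pair_fst)
  \<comment> \<open>\<open>matrix_inv\<close> is defined by choice, so its inverse property requires
    that some inverse exists; strict positive definiteness supplies one.\<close>
  then have "matrix_inv ?S ** ?S = mat 1"
    using strictly_pos_def_invertible unfolding matrix_inv_def invertible_def
    by (metis (mono_tags, lifting) someI_ex)
  then show ?thesis
    by (simp add: A_star_def sheared_configuration_def second_moment_matrix_distr
        second_moment_matrix_hidden_shear matrix_mul_assoc)
qed

text \<open>Since W is independent of X, the law of Z given X = x is the uniform law translated by
  A^T x. Fubini confirms that these translates form the conditional law.\<close>

lemma conditionally_continuous_sheared_configuration:
  "conditionally_continuous (law (sheared_configuration B A :: ('p::finite, 'm::finite, 'k::finite) configuration))
     predictor hidden"
proof -
  let ?M = "ball_pair :: ((real^'p) \<times> (real^'k)) measure"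
  let ?L = "distr ?M borel (shear A) :: ((real^'p) \<times> (real^'k) \<times> (real^'m)) measure"
  define \<kappa> :: "real^'p \<Rightarrow> (real^'k) measure"
    where "\<kappa> = (\<lambda>x. distr uniform_ball borel (\<lambda>w. w + transpose A *v x))"
  \<comment> \<open>\<open>\<kappa>\<close> pushes a constant kernel forward along a map jointly
    measurable in \<open>x\<close> and \<open>w\<close>, so it is itself a measurable
    kernel.\<close>
  have "(\<lambda>_. uniform_ball) \<in> borel \<rightarrow>\<^sub>M prob_algebra (borel :: (real^'k) measure)"
    by (rule measurable_const) (simp add: space_prob_algebra prob_space_uniform_ball)
  then have \<kappa>: "\<kappa> \<in> borel \<rightarrow>\<^sub>M prob_algebra borel"
    unfolding \<kappa>_def by (rule measurable_distr_prob_space2) measurable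
  have X: "distr ?L borel predictor = uniform_ball"
  proof -
    have "distr ?L borel predictor = distr ?M uniform_ball fst"
      by (subst distr_distr) (auto simp: comp_def intro!: distr_cong)
    then show ?thesis
      by (simp add: uniform_ball.distr_pair_fst)
  qed
  have "emeasure ?L {w \<in> space ?L. predictor w \<in> S \<and> hidden w \<in> T}
      = (\<integral>\<^sup>+x\<in>S. emeasure (\<kappa> x) T \<partial>uniform_ball)"
    if [measurable]: "S \<in> sets borel" "T \<in> sets borel" for S T
  proof -
    have "emeasure ?L {w \<in> space ?L. predictor w \<in> S \<and> hidden w \<in> T}
        = emeasure ?M {p \<in> space ?M. fst p \<in> S \<and> snd p + transpose A *v fst p \<in> T}"
      by (subst emeasure_distr) (auto intro!: arg_cong[where f = "emeasure ?M"])
    also have "\<dots> = (\<integral>\<^sup>+x. emeasure uniform_ball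
        (Pair x -` {p \<in> space ?M. fst p \<in> S \<and> snd p + transpose A *v fst p \<in> T}) \<partial>uniform_ball)"
      by (rule uniform_ball.emeasure_pair_measure_alt) measurable
    \<comment> \<open>The section at \<open>x\<close> is empty for \<open>x\<close> outside
      \<open>S\<close>, which gives the indicator; otherwise it is the preimage of \<open>T\<close>
      under the translation.\<close>
    also have "\<dots> = (\<integral>\<^sup>+x\<in>S. emeasure (\<kappa> x) T \<partial>uniform_ball)"
      by (intro nn_integral_cong)
        (auto simp: \<kappa>_def emeasure_distr space_pair_measure vimage_def indicator_def)
    finally show ?thesis .
  qed
  then have law: "regular_conditional_law ?L predictor hidden \<kappa>"
    unfolding regular_conditional_law_def X using \<kappa> by blast
  have "\<exists>f\<in>borel_measurable lborel. \<kappa> x = density lborel f" for x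
    unfolding \<kappa>_def by (rule distr_uniform_ball_plus)
  then show ?thesis
    unfolding conditionally_continuous_def sheared_configuration_def configuration.simps
    using law by (intro exI[of _ \<kappa>] conjI AE_I2)
qed

lemma sheared_configuration_in_class:
  assumes "rank (B :: real^'m^'k) = CARD('k)" "A \<noteq> 0"
  shows "(sheared_configuration B A :: ('p::finite, 'm::finite, 'k::finite) configuration)
           \<in> continuous_confounded_class"
  using assms
  by (simp add: continuous_confounded_class_def valid_sheared_configuration
      conditionally_continuous_sheared_configuration A_star_sheared_configuration)

section \<open>Observational equivalence\<close>

lemma response_sheared_configuration:
  "response (sheared_configuration B A) (shear A p) = transpose B *v snd p"
proof -
  \<comment> \<open>The direct effect of the predictor is exactly the negative of what reaches the
    response through the shifted part of the hidden variable, so the two cancel.\<close>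
  have "transpose (- (A ** B)) *v x = - (transpose B *v (transpose A *v x))" for x
    by (simp add: matrix_vector_mul_assoc flip: matrix_transpose_mul)
      (simp add: vec_eq_iff transpose_def matrix_vector_mult_def sum_negf)
  then show ?thesis
    by (simp add: response_def sheared_configuration_def matrix_vector_right_distrib)
qed

text \<open>The right-hand side is free of \<open>A\<close>: all members of the family with the same
  \<open>B\<close> are observationally equal.\<close>

lemma observed_law_sheared_configuration:
  "observed_law (sheared_configuration B A :: ('p::finite, 'm::finite, 'k::finite) configuration)
     = distr ball_pair borel (\<lambda>p. (fst p, transpose B *v snd p))"
proof -
  have [measurable]: "response (sheared_configuration B A) \<in> borel_measurable borel"
    unfolding response_def[abs_def] by measurable
  show ?thesis
    unfolding observed_law_def sheared_configuration_def configuration.simps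
    \<comment> \<open>Once \<open>law\<close> is projected out, the record left inside
      \<open>response\<close> is folded back so that \<open>response_sheared_configuration\<close>
      applies.\<close>
    unfolding sheared_configuration_def[symmetric]
    by (subst distr_distr)
      (simp_all add: comp_def response_sheared_configuration borel_measurable_Pair)
qed

section \<open>A full-rank loading matrix and the two witnesses\<close>

lemma exists_full_rank:
  assumes "CARD('k::finite) \<le> CARD('m::finite)"
  shows "\<exists>B :: real^'m^'k. rank B = CARD('k)"
proof -
  obtain f :: "'k \<Rightarrow> 'm" where f: "inj f"
    using assms card_le_inj[of "UNIV :: 'k set" "UNIV :: 'm set"] by auto
  \<comment> \<open>Row \<open>i\<close> is the unit vector at \<open>f i\<close>, so
    \<open>transpose B\<close> copies entry \<open>i\<close> of a vector to place \<open>f i\<close>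
    and is injective.\<close>
  define B :: "real^'m^'k" where "B = (\<chi> i j. if j = f i then 1 else 0)"
  have "(transpose B *v v) $ f i = v $ i" for v i
    using f by (simp add: B_def transpose_def matrix_vector_mult_def inj_eq if_distrib[of "\<lambda>x. x * _"]
        cong: if_cong)
  then have "inj ((*v) (transpose B))"
    by (metis injI vec_eq_iff)
  then show ?thesis
    by (metis full_rank_injective rank_transpose)
qed

theorem proposition1:
  assumes "CARD('k::finite) < CARD('m::finite)"
  shows "\<not> identifiable_over
           (continuous_confounded_class :: ('p::finite, 'm, 'k) configuration set)
           observed_law Psi"
proof -
  obtain B :: "real^'m^'k" where B: "rank B = CARD('k)"
    using exists_full_rank[where 'k = 'k and 'm = 'm] assms by auto
  \<comment> \<open>Full row rank gives a right inverse, by which \<open>B\<close> can be cancelled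
    when the two values of \<open>Psi\<close> are compared.\<close>
  obtain C :: "real^'k^'m" where C: "B ** C = mat 1"
    using B by (metis full_rank_surjective matrix_right_invertible_surjective)
  \<comment> \<open>Any nonzero matrix would serve: \<open>A\<close> and its double are distinct and
    both nonzero, so both configurations have nonzero \<open>A_star\<close>.\<close>
  define A :: "real^'k^'p" where "A = (\<chi> i j. 1)"
  have "A \<noteq> 0"
    by (simp add: A_def vec_eq_iff)
  then have ne: "A \<noteq> 2 *\<^sub>R A" "2 *\<^sub>R A \<noteq> 0"
    by (simp_all add: scaleR_2 A_def vec_eq_iff)
  have "A ** B \<noteq> (2 *\<^sub>R A) ** B"
    using ne(1) by (metis C matrix_mul_assoc matrix_mul_rid)
  then have "Psi (sheared_configuration B A) \<noteq> Psi (sheared_configuration B (2 *\<^sub>R A))"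
    by (simp add: sheared_configuration_def)
  moreover have "observed_law (sheared_configuration B A)
      = observed_law (sheared_configuration B (2 *\<^sub>R A))"
    by (simp add: observed_law_sheared_configuration)
  moreover have "sheared_configuration B A \<in> continuous_confounded_class"
    "sheared_configuration B (2 *\<^sub>R A) \<in> continuous_confounded_class"
    by (intro sheared_configuration_in_class B \<open>A \<noteq> 0\<close> ne)+
  ultimately show ?thesis
    unfolding identifiable_over_def by blast
qed

end
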